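(* Let $n\ge 1$, $k\in\mathbb{Z}$ and $a\in\mathbb{C}$ with $a\neq0$. Then \[ PC_{n}^{(k)}(x:a)=a^{-n}\sum_{m=0}^{n}\left\{\sum_{r=0}^{n-m}\sum_{l=0}^{n-m-r}\sum_{j=0}^{n-m-r-l}(-1)^{l+m}\binom{n-1}{r}\binom{n-r}{j+l}\binom{n-r-j-l}{m}\frac{a^{l}\,S_{2}(j+l,l)}{(n-r-j-l-m+1)^{k}}\,B_{r}^{(n)}\right\}x^{m}. \]
   Context: For an integer $k$, $\mathrm{Lif}_k(t)=\sum_{n=0}^{\infty}\frac{t^{n}}{n!\,(n+1)^{k}}$. For $a\neq0$, $PC_n^{(k)}(x:a)$ is defined by $e^{-t}\,\mathrm{Lif}_k\!\left(\log\left(1+\frac{t}{a}\right)\right)\left(1+\frac{t}{a}\right)^{-x}=\sum_{n\ge0}PC_n^{(k)}(x:a)\frac{t^n}{n!}$. $S_2(n,k)$ denotes the Stirling numbers of the second kind. $B_r^{(n)}$ denotes the Bernoulli numbers of order $n$, defined by $\left(\frac{t}{e^t-1}\right)^{n}=\sum_{r\ge0}B_r^{(n)}\frac{t^r}{r!}$. *)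

theory Defs
  imports
    Complex_Main
    "HOL-Computational_Algebra.Formal_Power_Series"
    "HOL-Combinatorics.Stirling"
begin

text \<open>
  All generating functions are read as formal power series over the complex numbers.
\<close>

definition Lif :: "int \<Rightarrow> complex fps" where
  "Lif k = Abs_fps (\<lambda>n. 1 / (fact n * of_nat (n + 1) powi k))"

text \<open>
  Here \<open>fps_ln 1\<close> is the series of log (1 + t) and \<open>fps_binomial (- x)\<close> is that of
  (1 + t) to the power -x; t is replaced by t / a by composing with
  \<open>fps_const (1 / a) * fps_X\<close>, which has no constant term.
\<close>

definition poly_cauchy_gf :: "int \<Rightarrow> complex \<Rightarrow> complex \<Rightarrow> complex fps" where
  "poly_cauchy_gf k x a =
     fps_exp (- 1)
     * (Lif k oo (fps_ln 1 oo (fps_const (1 / a) * fps_X)))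
     * (fps_binomial (- x) oo (fps_const (1 / a) * fps_X))"

definition PC :: "nat \<Rightarrow> int \<Rightarrow> complex \<Rightarrow> complex \<Rightarrow> complex" where
  "PC n k x a = fact n * fps_nth (poly_cauchy_gf k x a) n"

definition bernoulli_order :: "nat \<Rightarrow> nat \<Rightarrow> complex" where
  "bernoulli_order n r = fact r * fps_nth ((fps_X / (fps_exp 1 - 1)) ^ n) r"

end

theory Submission
  imports Defs
begin

unbundle fps_syntax

text \<open>
  Substituting \<open>t = a (e\<^sup>u - 1)\<close> turns the generating function into
  \<open>H(u) = exp (- a (e\<^sup>u - 1)) Lif\<^sub>k(u) e\<^bsup>- x u\<^esup>\<close>. Lagrange inversion expresses
  the \<open>n\<close>-th coefficient in \<open>t\<close> through that of \<open>H'(u) (u / (e\<^sup>u - 1))\<^sup>n\<close> at \<open>u\<^bsup>n-1\<^esup>\<close>,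
  which brings in the Bernoulli numbers of order \<open>n\<close>, while the powers of \<open>e\<^sup>u - 1\<close> in
  the exponential series contribute the Stirling numbers.
\<close>

text \<open>\<open>F ^ i\<close> has no coefficients below index \<open>i\<close>, so every inner
  sum of the composition can be extended to the common bound \<open>N\<close> before the sums are
  swapped.\<close>

lemma fps_compose_mult_nth:
  fixes C D F :: "'a::idom fps"
  assumes "F $ 0 = 0"
  shows "((C oo F) * D) $ N = (\<Sum>i=0..N. C $ i * (F ^ i * D) $ N)"
proof -
  have "((C oo F) * D) $ N = (\<Sum>j=0..N. (\<Sum>i=0..j. C $ i * (F ^ i) $ j) * D $ (N - j))"
    by (simp add: fps_mult_nth fps_compose_nth)
  also have "\<dots> = (\<Sum>j=0..N. (\<Sum>i=0..N. C $ i * (F ^ i) $ j) * D $ (N - j))"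
  proof (rule sum.cong[OF refl])
    fix j assume "j \<in> {0..N}"
    then have "(\<Sum>i=0..j. C $ i * (F ^ i) $ j) = (\<Sum>i=0..N. C $ i * (F ^ i) $ j)"
      using startsby_zero_power_prefix[OF assms] by (intro sum.mono_neutral_left) auto
    then show "(\<Sum>i=0..j. C $ i * (F ^ i) $ j) * D $ (N - j)
        = (\<Sum>i=0..N. C $ i * (F ^ i) $ j) * D $ (N - j)" by simp
  qed
  also have "\<dots> = (\<Sum>i=0..N. \<Sum>j=0..N. C $ i * (F ^ i) $ j * D $ (N - j))"
    by (subst sum.swap) (simp add: sum_distrib_right)
  also have "\<dots> = (\<Sum>i=0..N. C $ i * (F ^ i * D) $ N)"
    by (simp add: fps_mult_nth sum_distrib_left mult.assoc)
  finally show ?thesis .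
qed

text \<open>
  With \<open>P = X / F\<close> this says that \<open>F' / F\<^bsup>q+1\<^esup>\<close> has residue 1 if \<open>q = 0\<close> and 0 otherwise.
  Differentiating \<open>P F = X\<close> gives \<open>P\<^bsup>q+1\<^esup> F' = P\<^sup>q - X (P\<^sup>q)' / q\<close>.
\<close>

lemma fps_deriv_mult_power_nth:
  fixes F P :: "'a::field_char_0 fps"
  assumes F0: "F $ 0 = 0" and PF: "P * F = fps_X"
  shows "(fps_deriv F * P ^ Suc q) $ q = (if q = 0 then 1 else 0)"
proof -
  have d: "P * fps_deriv F = 1 - fps_deriv P * F"
    using arg_cong[OF PF, of fps_deriv] by (simp add: algebra_simps)
  show ?thesis
  proof (cases q)
    case 0
    then show ?thesis
      using arg_cong[OF PF, of "\<lambda>f. f $ 1"] F0 by (simp add: mult.commute)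
  next
    case (Suc p)
    have "fps_const (of_nat q) * (fps_deriv F * P ^ Suc q)
        = fps_const (of_nat q) * (P ^ q * (P * fps_deriv F))"
      by (simp add: mult_ac)
    also have "\<dots> = fps_const (of_nat q) * P ^ q
        - (P * F) * (fps_const (of_nat q) * fps_deriv P * P ^ p)"
      unfolding d by (simp add: Suc algebra_simps)
    also have "\<dots> = fps_const (of_nat q) * P ^ q - fps_X * fps_deriv (P ^ q)"
      by (simp only: PF fps_deriv_power Suc diff_Suc_1)
    finally have "(fps_const (of_nat q) * (fps_deriv F * P ^ Suc q)) $ q
        = (fps_const (of_nat q) * P ^ q - fps_X * fps_deriv (P ^ q)) $ q"
      by (rule arg_cong)
    \<comment> \<open>At index \<open>q\<close>, \<open>fps_X * fps_deriv (P ^ q)\<close> also has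
      coefficient \<open>q\<close> times that of \<open>P ^ q\<close>, so the difference
      cancels.\<close>
    then have "of_nat q * (fps_deriv F * P ^ Suc q) $ q = 0"
      by (simp add: Suc del: power_Suc)
    then show ?thesis using Suc by (simp del: power_Suc of_nat_Suc)
  qed
qed

text \<open>The chain rule writes the derivative of \<open>C oo F\<close> as the sum of
  \<open>C' $ i * F ^ i * F'\<close>, where the prime is the derivative. Here \<open>P\<close> plays
  the role of X / F, which keeps the residue argument inside power series: only
  \<open>i = n - 1\<close> survives.\<close>

lemma fps_lagrange_inversion:
  fixes C F P :: "'a::field_char_0 fps"
  assumes F0: "F $ 0 = 0" and PF: "P * F = fps_X" and n: "n \<ge> 1"
  shows "of_nat n * C $ n = (fps_deriv (C oo F) * P ^ n) $ (n - 1)"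
proof -
  have coeff: "(F ^ i * (fps_deriv F * P ^ n)) $ (n - 1) = (if i = n - 1 then 1 else 0)"
    if i: "i \<le> n - 1" for i
  proof -
    \<comment> \<open>Pairing \<open>F ^ i\<close> with \<open>i\<close> of the \<open>n\<close>
      factors \<open>P\<close> gives \<open>fps_X ^ i\<close> and leaves \<open>Suc q\<close>
      factors.\<close>
    define q where "q = n - 1 - i"
    have nq: "n = Suc q + i" using i n by (simp add: q_def)
    have "F ^ i * (fps_deriv F * P ^ n) = (P * F) ^ i * (fps_deriv F * P ^ Suc q)"
      unfolding nq power_add power_mult_distrib by (simp add: mult_ac)
    also have "\<dots> = fps_X ^ i * (fps_deriv F * P ^ Suc q)"
      by (simp only: PF)
    also have "\<dots> $ (n - 1) = (fps_deriv F * P ^ Suc q) $ q"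
      unfolding fps_X_power_mult_nth using i by (simp add: q_def del: power_Suc)
    finally show ?thesis
      using fps_deriv_mult_power_nth[OF F0 PF, of q] i by (auto simp: q_def)
  qed
  have "(fps_deriv (C oo F) * P ^ n) $ (n - 1)
      = ((fps_deriv C oo F) * (fps_deriv F * P ^ n)) $ (n - 1)"
    by (simp add: fps_compose_deriv[OF F0] mult.assoc)
  also have "\<dots> = (\<Sum>i=0..n-1. fps_deriv C $ i * (if i = n - 1 then 1 else 0))"
    unfolding fps_compose_mult_nth[OF F0] by (intro sum.cong refl) (simp only: coeff atLeastAtMost_iff)
  also have "\<dots> = fps_deriv C $ (n - 1)"
    by (simp add: if_distrib cong: if_cong)
  also have "\<dots> = of_nat n * C $ n" using n by (simp del: of_nat_Suc)
  finally show ?thesis ..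
qed

text \<open>With E = e^u - 1 we have E' = E + 1, so (E^(p+1))' = (p+1) (E^(p+1) + E^p). On
  coefficients this is the recurrence of the Stirling numbers.\<close>

lemma fps_exp_minus_one_power_nth:
  "(fps_exp (1::'a::field_char_0) - 1) ^ l $ N = fact l * of_nat (Stirling N l) / fact N"
proof (induction N arbitrary: l)
  case 0
  show ?case by (cases l) auto
next
  case (Suc N)
  let ?E = "fps_exp (1::'a) - 1"
  show ?case
  proof (cases l)
    case 0
    then show ?thesis by simp
  next
    case (Suc p)
    have "fps_deriv (?E ^ Suc p) = fps_const (of_nat (Suc p)) * (?E ^ Suc p + ?E ^ p)"
      unfolding fps_deriv_power by (simp add: algebra_simps del: of_nat_Suc)
    then have "of_nat (Suc N) * ?E ^ Suc p $ Suc N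
        = of_nat (Suc p) * (?E ^ Suc p $ N + ?E ^ p $ N)"
      by (metis Suc_eq_plus1 fps_add_nth fps_deriv_nth fps_mult_left_const_nth)
    also have "\<dots> = fact (Suc p) * of_nat (Stirling (Suc N) (Suc p)) / fact N"
      unfolding Suc.IH by (simp add: field_simps)
    finally show ?thesis
      using Suc by (simp add: field_simps del: of_nat_Suc power_Suc Stirling.simps)
  qed
qed

lemma fps_exp_compose_exp_minus_one_nth:
  "(fps_exp c oo (fps_exp 1 - 1)) $ N
     = (\<Sum>l=0..N. c ^ l * of_nat (Stirling N l)) / fact N" for c :: "'a::field_char_0"
  by (simp add: fps_compose_nth fps_exp_minus_one_power_nth sum_divide_distrib)

text \<open>The binomial series B solves (1 + X) B' = c B. Under the substitution 1 + X becomes e^u,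
  which is also the factor from the chain rule, so the composite f satisfies f' = c f with f(0) =
  1.\<close>

lemma fps_binomial_compose_exp_minus_one:
  "fps_binomial c oo (fps_exp 1 - 1) = fps_exp c" for c :: "'a::field_char_0"
proof -
  let ?E = "fps_exp (1::'a) - 1" and ?f = "fps_binomial c oo (fps_exp 1 - 1)"
  have "(1 + fps_X) * fps_deriv (fps_binomial c) = fps_const c * fps_binomial c"
    by (simp add: fps_binomial_deriv fps_divide_unit mult.left_commute inverse_mult_eq_1')
  then have "((1 + fps_X) * fps_deriv (fps_binomial c)) oo ?E = (fps_const c * fps_binomial c) oo ?E"
    by simp
  then have "fps_exp 1 * (fps_deriv (fps_binomial c) oo ?E) = fps_const c * ?f"
    by (simp add: fps_compose_mult_distrib fps_compose_add_distrib)
  then have "fps_deriv ?f = fps_const c * ?f"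
    by (simp add: fps_compose_deriv mult.commute)
  then show ?thesis
    unfolding fps_exp_unique_ODE by simp
qed

lemma fps_ln_compose_exp_minus_one:
  "fps_ln 1 oo (fps_exp 1 - 1) = (fps_X :: 'a::field_char_0 fps)"
  by (simp add: fps_ln_fps_exp_inv fps_inv)

text \<open>The quotient is exact because the divisor has subdegree 1 and hence divides X.\<close>

lemma fps_X_div_exp_minus_one_mult:
  "fps_X / (fps_exp 1 - 1) * (fps_exp 1 - 1) = (fps_X :: 'a::field_char_0 fps)"
proof -
  have "subdegree (fps_exp (1::'a) - 1) = 1"
    by (rule subdegreeI) auto
  then show ?thesis
    by (intro dvd_div_mult_self) (simp add: fps_dvd_iff)
qed

text \<open>Writing e^(-t) as exp(-a (t/a)) makes the whole generating function a series in t/a, so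
  the scaling contributes just the power of \<open>a\<close>.\<close>

lemma poly_cauchy_gf_nth:
  assumes "a \<noteq> 0"
  shows "poly_cauchy_gf k x a $ n
    = a powi (- int n) * (fps_exp (- a) * (Lif k oo fps_ln 1) * fps_binomial (- x)) $ n"
proof -
  let ?L = "fps_const (1 / a) * fps_X"
  have "poly_cauchy_gf k x a = (fps_exp (- a) * (Lif k oo fps_ln 1) * fps_binomial (- x)) oo ?L"
    using assms by (simp add: poly_cauchy_gf_def fps_compose_mult_distrib fps_compose_assoc)
  then show ?thesis
    by (simp only: fps_nth_compose_linear) (simp add: power_int_minus power_inverse divide_inverse)
qed

lemma exp_mult_Lif_nth:
  fixes c x :: complex
  shows "fact M * (fps_exp (- x) * ((fps_exp c oo (fps_exp 1 - 1)) * Lif k)) $ M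
    = (\<Sum>m=0..M. \<Sum>l=0..M-m. \<Sum>j=0..M-m-l.
         of_nat (M choose (j + l)) * of_nat ((M - j - l) choose m) * (- x) ^ m
         * (c ^ l * of_nat (Stirling (j + l) l) / of_nat (M - j - l - m + 1) powi k))"
proof -
  let ?g = "\<lambda>m N l. of_nat (M choose N) * of_nat ((M - N) choose m) * (- x) ^ m
         * (c ^ l * of_nat (Stirling N l) / of_nat (M - N - m + 1) powi k)"
  \<comment> \<open>The three factors contribute the orders \<open>m\<close>, \<open>N\<close> and
    \<open>M - m - N\<close>; this splits their multinomial coefficient into the two binomials of
    the target.\<close>
  have multinom: "fact M / (fact m * fact N * fact (M - m - N))
      = (of_nat (M choose N) * of_nat ((M - N) choose m) :: complex)"
    if "m + N \<le> M" for m N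
  proof -
    have "M - N - m = M - m - N" by simp
    with that show ?thesis
      by (simp add: binomial_fact[where 'a = complex])
  qed
  have summand: "fact M * ((- x) ^ m / fact m * ((\<Sum>l=0..N. c ^ l * of_nat (Stirling N l)) / fact N
        * Lif k $ (M - m - N))) = (\<Sum>l=0..N. ?g m N l)" if "m + N \<le> M" for m N
  proof -
    have e: "M - N - m = M - m - N" by simp
    have "(\<Sum>l=0..N. ?g m N l) = of_nat (M choose N) * of_nat ((M - N) choose m) * (- x) ^ m
        * ((\<Sum>l=0..N. c ^ l * of_nat (Stirling N l)) / of_nat (M - N - m + 1) powi k)"
      by (simp only: sum_distrib_left sum_divide_distrib)
    also have "\<dots> = fact M / (fact m * fact N * fact (M - m - N)) * (- x) ^ m
        * ((\<Sum>l=0..N. c ^ l * of_nat (Stirling N l)) / of_nat (M - N - m + 1) powi k)"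
      by (simp only: multinom[OF that])
    also have "\<dots> = fact M * ((- x) ^ m / fact m *
        ((\<Sum>l=0..N. c ^ l * of_nat (Stirling N l)) / fact N * Lif k $ (M - m - N)))"
      unfolding e Lif_def by (simp add: mult.assoc)
    finally show ?thesis ..
  qed
  have "fact M * (fps_exp (- x) * ((fps_exp c oo (fps_exp 1 - 1)) * Lif k)) $ M
    = (\<Sum>m=0..M. \<Sum>N=0..M-m. fact M * ((- x) ^ m / fact m *
        ((\<Sum>l=0..N. c ^ l * of_nat (Stirling N l)) / fact N * Lif k $ (M - m - N))))"
    by (simp add: fps_mult_nth[of "fps_exp (- x)"] fps_mult_nth[of "fps_exp c oo _"]
        fps_exp_compose_exp_minus_one_nth sum_distrib_left)
  also have "\<dots> = (\<Sum>m=0..M. \<Sum>N=0..M-m. \<Sum>l=0..N. ?g m N l)"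
    by (intro sum.cong refl summand) auto
  \<comment> \<open>Put \<open>N = j + l\<close> on the triangle l \<le> N \<le> M - m.\<close>
  also have "\<dots> = (\<Sum>m=0..M. \<Sum>l=0..M-m. \<Sum>j=0..M-m-l. ?g m (j + l) l)"
  proof (rule sum.cong[OF refl])
    fix m
    show "(\<Sum>N=0..M-m. \<Sum>l=0..N. ?g m N l) = (\<Sum>l=0..M-m. \<Sum>j=0..M-m-l. ?g m (j + l) l)"
      unfolding sum.Sigma[OF finite_atLeastAtMost ballI[OF finite_atLeastAtMost]]
      by (rule sum.reindex_bij_witness[of _ "\<lambda>(l, j). (j + l, l)" "\<lambda>(N, l). (l, N - l)"]) auto
  qed
  finally show ?thesis by simp
qed

theorem theorem5:
  fixes n :: nat and k :: int and a x :: complex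
  assumes "n \<ge> 1" and "a \<noteq> 0"
  shows "PC n k x a =
    a powi (- int n) *
    (\<Sum>m=0..n.
      (\<Sum>r=0..n-m. \<Sum>l=0..n-m-r. \<Sum>j=0..n-m-r-l.
         (-1) ^ (l + m)
         * of_nat ((n - 1) choose r)
         * of_nat ((n - r) choose (j + l))
         * of_nat ((n - r - j - l) choose m)
         * (a ^ l * of_nat (Stirling (j + l) l)
            / of_nat (n - r - j - l - m + 1) powi k)
         * bernoulli_order n r)
      * x ^ m)"
proof -
  let ?E = "fps_exp (1::complex) - 1"
  define G where "G = fps_exp (- a) * (Lif k oo fps_ln 1) * fps_binomial (- x)"
  define H where "H = fps_exp (- x) * ((fps_exp (- a) oo ?E) * Lif k)"
  have GH: "G oo ?E = H"
    by (simp add: G_def H_def fps_compose_mult_distrib fps_binomial_compose_exp_minus_one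
        fps_compose_assoc[symmetric] fps_ln_compose_exp_minus_one mult_ac)
  have "of_nat n * G $ n = (fps_deriv H * (fps_X / ?E) ^ n) $ (n - 1)"
    using fps_lagrange_inversion[OF _ fps_X_div_exp_minus_one_mult \<open>n \<ge> 1\<close>, of G]
    by (simp add: GH)
  \<comment> \<open>The derivative of \<open>H\<close> has coefficient
    \<open>(n - r) * H $ (n - r)\<close> at index \<open>n - 1 - r\<close>.\<close>
  also have "\<dots> = (\<Sum>r=0..n-1. ((fps_X / ?E) ^ n) $ r * (of_nat (n - r) * H $ (n - r)))"
    unfolding mult.commute[of "fps_deriv H"] fps_mult_nth using \<open>n \<ge> 1\<close>
    by (intro sum.cong refl) (auto simp: Suc_diff_Suc simp del: of_nat_Suc)
  finally have lagrange: "of_nat n * G $ n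
      = (\<Sum>r=0..n-1. ((fps_X / ?E) ^ n) $ r * (of_nat (n - r) * H $ (n - r)))" .
  have "fact n * G $ n = fact (n - 1) * (of_nat n * G $ n)"
    using \<open>n \<ge> 1\<close> by (simp add: fact_reduce mult_ac)
  also have "\<dots> = (\<Sum>r=0..n-1. of_nat ((n - 1) choose r) * bernoulli_order n r
      * (fact (n - r) * H $ (n - r)))"
    unfolding lagrange sum_distrib_left
  proof (intro sum.cong refl)
    fix r assume "r \<in> {0..n-1}"
    then have r: "r \<le> n - 1" "n - r > 0" "n - r - 1 = n - 1 - r" using \<open>n \<ge> 1\<close> by auto
    have "fact (n - r) = (of_nat (n - r) * fact (n - 1 - r) :: complex)"
      using r by (simp add: fact_reduce)
    then show "fact (n - 1) * ((fps_X / ?E) ^ n $ r * (of_nat (n - r) * H $ (n - r)))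
      = of_nat ((n - 1) choose r) * bernoulli_order n r * (fact (n - r) * H $ (n - r))"
      using r by (simp add: bernoulli_order_def binomial_fact[where 'a = complex])
  qed
  \<comment> \<open>The added term \<open>r = n\<close> vanishes since
    \<open>(n - 1) choose n = 0\<close>; it completes the triangle m + r \<le> n for the later swap
    of sums.\<close>
  also have "\<dots> = (\<Sum>r=0..n. of_nat ((n - 1) choose r) * bernoulli_order n r
      * (fact (n - r) * H $ (n - r)))"
    using \<open>n \<ge> 1\<close> by (intro sum.mono_neutral_left) auto
  \<comment> \<open>The sign \<open>(-1) ^ (l + m)\<close> collects those of
    \<open>(- a) ^ l\<close> and \<open>(- x) ^ m\<close>.\<close>
  also have "\<dots> = (\<Sum>r=0..n. \<Sum>m=0..n-r. (\<Sum>l=0..n-m-r. \<Sum>j=0..n-m-r-l.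
         (-1) ^ (l + m)
         * of_nat ((n - 1) choose r)
         * of_nat ((n - r) choose (j + l))
         * of_nat ((n - r - j - l) choose m)
         * (a ^ l * of_nat (Stirling (j + l) l)
            / of_nat (n - r - j - l - m + 1) powi k)
         * bernoulli_order n r) * x ^ m)"
    unfolding H_def exp_mult_Lif_nth sum_distrib_left sum_distrib_right
    by (intro sum.cong refl)
      (auto simp: power_add power_minus[of x] power_minus[of a] diff_commute[of n] mult_ac)
  also have "\<dots> = (\<Sum>m=0..n. \<Sum>r=0..n-m. (\<Sum>l=0..n-m-r. \<Sum>j=0..n-m-r-l.
         (-1) ^ (l + m)
         * of_nat ((n - 1) choose r)
         * of_nat ((n - r) choose (j + l))
         * of_nat ((n - r - j - l) choose m)
         * (a ^ l * of_nat (Stirling (j + l) l)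
            / of_nat (n - r - j - l - m + 1) powi k)
         * bernoulli_order n r) * x ^ m)"
    unfolding sum.Sigma[OF finite_atLeastAtMost ballI[OF finite_atLeastAtMost]]
    by (rule sum.reindex_bij_witness[of _ "\<lambda>(m, r). (r, m)" "\<lambda>(r, m). (m, r)"]) auto
  finally show ?thesis
    by (simp add: PC_def poly_cauchy_gf_nth[OF \<open>a \<noteq> 0\<close>] G_def[symmetric]
        sum_distrib_right mult.left_commute[of "fact n"])
qed

end
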